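(* Let $$\mathcal U^{\mathrm{DTBP}}:=\big\{\{(1,0),(0,1)\},\ \{(-1,-1),(0,1)\},\ \{(-1,-1),(1,0)\}\big\}$$ be the update family of directed triangular bootstrap percolation on $\mathbb Z^2$. Then $p_{\mathrm c}(\mathcal U^{\mathrm{DTBP}})>2.8\cdot 10^{-6}$.
   Context: Let $\mathcal U$ be a finite family of finite subsets of $\mathbb Z^d\setminus\{o\}$, where $o$ is the origin (here $d=2$). Given a set $X=X_0\subset\mathbb Z^d$, define for $t\ge 0$ $$X_{t+1}:=X_t\cup\{i\in\mathbb Z^d:\ \exists U\in\mathcal U \text{ with } i+U\subset X_t\},\qquad [X]:=\bigcup_{t\ge 0}X_t .$$ Let $\mathbb P_p$ be the law under which each site of $\mathbb Z^d$ belongs to $X$ independently with probability $p$. The critical parameter is $$p_{\mathrm c}(\mathcal U):=\inf\{p\in[0,1]:\ \mathbb P_p([X]=\mathbb Z^d)=1\}.$$ *)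

theory Defs
  imports "HOL-Probability.Probability"
begin

type_synonym site = "int \<times> int"

definition bootstrap_step :: "site set set \<Rightarrow> site set \<Rightarrow> site set" where
  "bootstrap_step \<U> X = X \<union> {i. \<exists>U\<in>\<U>. (+) i ` U \<subseteq> X}"

primrec bootstrap_iter :: "site set set \<Rightarrow> site set \<Rightarrow> nat \<Rightarrow> site set" where
  "bootstrap_iter \<U> X 0 = X"
| "bootstrap_iter \<U> X (Suc t) = bootstrap_step \<U> (bootstrap_iter \<U> X t)"

definition bootstrap_closure :: "site set set \<Rightarrow> site set \<Rightarrow> site set" where
  "bootstrap_closure \<U> X = (\<Union>t. bootstrap_iter \<U> X t)"

text \<open>
  A configuration is the indicator \<open>\<omega>\<close> of the random set \<open>{x. \<omega> x}\<close>. Only parameters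
  \<open>p \<in> {0..1}\<close> are meaningful here, since \<open>bernoulli_pmf\<close> truncates its argument to \<open>[0, 1]\<close>.
\<close>

definition site_measure :: "real \<Rightarrow> (site \<Rightarrow> bool) measure" where
  "site_measure p = (\<Pi>\<^sub>M x\<in>UNIV. measure_pmf (bernoulli_pmf p))"

definition critical_parameter :: "site set set \<Rightarrow> real" where
  "critical_parameter \<U> =
     Inf {p \<in> {0..1}.
       measure (site_measure p)
         {\<omega> \<in> space (site_measure p). bootstrap_closure \<U> {x. \<omega> x} = UNIV} = 1}"

definition DTBP :: "site set set" where
  "DTBP = {{(1, 0), (0, 1)}, {(-1, -1), (0, 1)}, {(-1, -1), (1, 0)}}"

text \<open>
  The event in \<open>critical_parameter\<close> is measurable, so its \<open>measure\<close> is not the junk value 0,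
  and the infimum is taken over a nonempty set that is bounded below.
\<close>

lemma space_site_measure [simp]: "space (site_measure p) = UNIV"
  by (simp add: site_measure_def space_PiM PiE_UNIV_domain)

lemma prob_space_site_measure: "prob_space (site_measure p)"
  unfolding site_measure_def by (intro prob_space_PiM measure_pmf.prob_space_axioms)

lemma pred_bootstrap_iter:
  assumes "finite \<U>" "\<And>U. U \<in> \<U> \<Longrightarrow> finite U"
  shows "Measurable.pred (site_measure p) (\<lambda>\<omega>. x \<in> bootstrap_iter \<U> {x. \<omega> x} t)"
proof (induction t arbitrary: x)
  case 0
  have "(\<lambda>\<omega>. \<omega> x) \<in> measurable (site_measure p) (measure_pmf (bernoulli_pmf p))"
    unfolding site_measure_def by (rule measurable_component_singleton) simp
  then show ?case by (simp add: measurable_def)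
next
  case (Suc t)
  note [measurable] = Suc
  have "Measurable.pred (site_measure p) (\<lambda>\<omega>. x \<in> bootstrap_iter \<U> {x. \<omega> x} t \<or>
      (\<exists>U\<in>\<U>. \<forall>y\<in>U. x + y \<in> bootstrap_iter \<U> {x. \<omega> x} t))"
    using assms by (intro pred_intros_logic pred_intros_finite Suc) auto
  then show ?case by (simp add: bootstrap_step_def image_subset_iff)
qed

lemma sets_bootstrap_closure_event:
  assumes "finite \<U>" "\<And>U. U \<in> \<U> \<Longrightarrow> finite U"
  shows "{\<omega> \<in> space (site_measure p). bootstrap_closure \<U> {x. \<omega> x} = UNIV} \<in> sets (site_measure p)"
proof -
  note [measurable] = pred_bootstrap_iter[OF assms]
  have "{\<omega> \<in> space (site_measure p). \<forall>x. \<exists>t. x \<in> bootstrap_iter \<U> {x. \<omega> x} t} \<in> sets (site_measure p)"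
    by measurable
  moreover have "bootstrap_closure \<U> X = UNIV \<longleftrightarrow> (\<forall>x. \<exists>t. x \<in> bootstrap_iter \<U> X t)" for X
    by (auto simp: bootstrap_closure_def set_eq_iff)
  ultimately show ?thesis by simp
qed

lemma bootstrap_closure_UNIV: "bootstrap_closure \<U> UNIV = UNIV"
proof -
  have "UNIV = bootstrap_iter \<U> UNIV 0" by simp
  then show ?thesis unfolding bootstrap_closure_def by blast
qed

lemma one_in_critical_set:
  assumes "finite \<U>" "\<And>U. U \<in> \<U> \<Longrightarrow> finite U"
  shows "1 \<in> {p \<in> {0..1::real}.
    measure (site_measure p)
      {\<omega> \<in> space (site_measure p). bootstrap_closure \<U> {x. \<omega> x} = UNIV} = 1}"
proof -
  interpret prob_space "site_measure 1" by (rule prob_space_site_measure)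
  have "AE \<omega> in site_measure 1. \<omega> x" for x
  proof -
    have "AE b in measure_pmf (bernoulli_pmf 1). b"
    proof -
      have "y" if "pmf (bernoulli_pmf 1) y \<noteq> 0" for y
        using that by (cases y) auto
      then show ?thesis by (auto simp: AE_measure_pmf_iff set_pmf_iff)
    qed
    then show ?thesis
      unfolding site_measure_def
      by (intro AE_PiM_component[where M = "\<lambda>_. measure_pmf (bernoulli_pmf 1)"])
         (auto intro: measure_pmf.prob_space_axioms)
  qed
  then have "AE \<omega> in site_measure 1. \<forall>x. \<omega> x" by (simp add: AE_all_countable)
  then have "AE \<omega> in site_measure 1. bootstrap_closure \<U> {x. \<omega> x} = UNIV"
    by eventually_elim (simp add: bootstrap_closure_UNIV flip: UNIV_def del: split_paired_All)
  then show ?thesis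
    using prob_Collect_eq_1[OF sets_bootstrap_closure_event[OF assms]] by simp
qed

end

theory Submission
  imports Defs
begin

text \<open>
  The linear forms \<open>L\<^sub>1 = y - 2x\<close>, \<open>L\<^sub>2 = x - 2y\<close>, \<open>L\<^sub>3 = x + y\<close> sum to zero, and each of them
  grows by 1 along two of the three directions and drops by 2 along the third. Hence of any two
  directions at least one increases a given form. Infecting the sites one at a time and following
  the clusters they form, one finds for any three sites \<open>u, v, z\<close> of a cluster a tree of lattice
  edges containing them, with \<open>n\<close> initially infected sites (those without outgoing edge) and at
  most \<open>5 (n - 1) - L\<^sub>1 u - L\<^sub>2 v - L\<^sub>3 z\<close> edges. For \<open>u = v = z = 0\<close> an infected origin lies in
  a tree with \<open>m \<le> 5 (n - 1)\<close> edges whose \<open>n\<close> sinks are initially infected.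

  These trees are counted by bond percolation: the events that the open cluster of the origin
  is a given tree are disjoint, and at density \<open>1/5\<close> a tree with \<open>m\<close> edges has
  probability at least \<open>(1/5)\<^sup>m (4/5)\<^bsup>4m+6\<^esup>\<close>. The union bound over trees therefore converges, to
  a sum below 1, as soon as \<open>p \<le> (256/3125)\<^sup>5\<close>, which is about \<open>3.69 * 10\<^bsup>-6\<^esup>\<close>.
\<close>

section \<open>Trees in the directed triangular lattice\<close>

definition edges :: "(site \<times> site) set" where
  "edges = {(u, v). v - u \<in> {(1, 0), (0, 1), (-1, -1)}}"

text \<open>Connectedness ignores orientation. Together with having one vertex more than edges it
  forces a nonempty tree, so acyclicity need not be stated.\<close>

definition lattice_tree :: "site set \<Rightarrow> (site \<times> site) set \<Rightarrow> bool" where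
  "lattice_tree V E \<longleftrightarrow> finite V \<and> E \<subseteq> edges \<inter> V \<times> V \<and> card V = Suc (card E) \<and>
     (\<forall>u\<in>V. \<forall>v\<in>V. (u, v) \<in> (E \<union> E\<inverse>)\<^sup>*)"

lemma lattice_tree_singleton: "lattice_tree {v} {}"
  by (simp add: lattice_tree_def)

lemma lattice_tree_finite:
  assumes "lattice_tree V E"
  shows "finite V" "finite E"
  using assms finite_subset[of E "V \<times> V"] by (auto simp: lattice_tree_def)

lemma lattice_tree_join:
  assumes T: "lattice_tree V E" "lattice_tree V' E'" and disj: "V \<inter> V' = {}"
    and uv: "u \<in> V" "v \<in> V'" "(u, v) \<in> edges"
  shows "lattice_tree (V \<union> V') (insert (u, v) (E \<union> E'))"
proof -
  let ?F = "insert (u, v) (E \<union> E')"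
  have fin: "finite V" "finite E" "finite V'" "finite E'"
    using T by (auto dest: lattice_tree_finite)
  have sub: "E \<subseteq> edges \<inter> V \<times> V" "E' \<subseteq> edges \<inter> V' \<times> V'"
    using T by (auto simp: lattice_tree_def)
  have "E \<inter> E' = {}" "(u, v) \<notin> E \<union> E'"
    using sub disj uv by auto
  then have "card ?F = Suc (card E + card E')"
    using fin by (simp add: card_Un_disjoint)
  moreover have "card (V \<union> V') = card V + card V'"
    using fin disj by (simp add: card_Un_disjoint)
  ultimately have card: "card (V \<union> V') = Suc (card ?F)"
    using T by (simp add: lattice_tree_def)
  let ?R = "(?F \<union> ?F\<inverse>)\<^sup>*"
  have mono: "(E \<union> E\<inverse>)\<^sup>* \<subseteq> ?R" "(E' \<union> E'\<inverse>)\<^sup>* \<subseteq> ?R"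
    by (auto intro!: rtrancl_mono)
  \<comment> \<open>Reachability is symmetric, so connecting every site to \<open>u\<close> is
    enough.\<close>
  have to_u: "(x, u) \<in> ?R" if "x \<in> V \<union> V'" for x
  proof (cases "x \<in> V")
    case True
    then show ?thesis using T(1) uv(1) mono(1) by (auto simp: lattice_tree_def)
  next
    case False
    then have "(x, v) \<in> ?R"
      using that T(2) uv(2) mono(2) by (auto simp: lattice_tree_def)
    moreover have "(v, u) \<in> ?R" by (intro r_into_rtrancl) simp
    ultimately show ?thesis by (rule rtrancl_trans)
  qed
  have "sym ?R" by (intro sym_rtrancl) (auto simp: sym_def)
  then have "(x, y) \<in> ?R" if "x \<in> V \<union> V'" "y \<in> V \<union> V'" for x y
    using to_u[OF that(1)] to_u[OF that(2)] by (meson rtrancl_trans symE)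
  then show ?thesis
    using fin sub uv card unfolding lattice_tree_def by blast
qed

section \<open>Linear forms and clusters spanned by trees\<close>

definition wt1 :: "site \<Rightarrow> int" where "wt1 v = snd v - 2 * fst v"
definition wt2 :: "site \<Rightarrow> int" where "wt2 v = fst v - 2 * snd v"
definition wt3 :: "site \<Rightarrow> int" where "wt3 v = fst v + snd v"

lemmas wt_defs = wt1_def wt2_def wt3_def

text \<open>An edge points from a site to one of the sites that can help to infect it. Sinks are
  thus the sites whose infection the tree leaves unexplained; a site added with an outgoing edge is
  never one of them.\<close>

definition sinks :: "site set \<Rightarrow> (site \<times> site) set \<Rightarrow> site set" where
  "sinks V E = V - Domain E"

text \<open>There is one terminal per linear form, and all three are arbitrary: in a merger the tree
  on each side can then be made to contain the child of \<open>w\<close> at which it is attached.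
  \<open>V \<subseteq> C\<close> keeps trees of disjoint clusters disjoint.\<close>

definition spanned :: "site set \<Rightarrow> site set \<Rightarrow> bool" where
  "spanned X C \<longleftrightarrow> (\<forall>u\<in>C. \<forall>v\<in>C. \<forall>z\<in>C. \<exists>V E. lattice_tree V E \<and> V \<subseteq> C \<and> {u, v, z} \<subseteq> V \<and>
     sinks V E \<subseteq> X \<and> int (card E) + wt1 u + wt2 v + wt3 z \<le> 5 * (int (card (sinks V E)) - 1))"

lemma spannedE:
  assumes "spanned X C" "u \<in> C" "v \<in> C" "z \<in> C"
  obtains V E where "lattice_tree V E" "V \<subseteq> C" "u \<in> V" "v \<in> V" "z \<in> V" "sinks V E \<subseteq> X"
    "int (card E) + wt1 u + wt2 v + wt3 z \<le> 5 * (int (card (sinks V E)) - 1)"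
  using assms unfolding spanned_def by (metis insert_subset)

lemma spanned_singleton: "x \<in> X \<Longrightarrow> spanned X {x}"
  unfolding spanned_def
  by (intro ballI exI[of _ "{x}"] exI[of _ "{}"])
     (auto simp: lattice_tree_singleton sinks_def wt_defs)

definition children :: "site \<Rightarrow> site \<Rightarrow> site \<Rightarrow> bool" where
  "children w a b \<longleftrightarrow> (a, b) \<in>
     {(w + (1, 0), w + (0, 1)), (w + (-1, -1), w + (0, 1)), (w + (-1, -1), w + (1, 0))}"

lemma children_edges: "children w a b \<Longrightarrow> (w, a) \<in> edges" "children w a b \<Longrightarrow> (w, b) \<in> edges"
  by (auto simp: children_def edges_def)

text \<open>Each form grows by 1 at one of the two children. Moving the terminals at
  \<open>w\<close> to such children raises the total weight by at least 1, which pays for the single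
  edge that attaches \<open>w\<close>. The sinks do not change.\<close>

lemma spanned_insert:
  assumes C: "spanned X C" and w: "w \<notin> C" and ch: "children w a b" and ab: "a \<in> C" "b \<in> C"
  shows "spanned X (insert w C)"
  unfolding spanned_def
proof (intro ballI)
  fix u v z assume uvz: "u \<in> insert w C" "v \<in> insert w C" "z \<in> insert w C"
  have "\<exists>c\<in>{a, b}. wt1 c = wt1 w + 1" "\<exists>c\<in>{a, b}. wt2 c = wt2 w + 1"
    "\<exists>c\<in>{a, b}. wt3 c = wt3 w + 1"
    using ch by (auto simp: children_def wt_defs)
  then obtain c1 c2 c3 where c: "c1 \<in> {a, b}" "c2 \<in> {a, b}" "c3 \<in> {a, b}"
    "wt1 c1 = wt1 w + 1" "wt2 c2 = wt2 w + 1" "wt3 c3 = wt3 w + 1"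
    by metis
  \<comment> \<open>A terminal at \<open>w\<close> moves to the child at which its own form grows;
    the others stay in place.\<close>
  define f where "f = (\<lambda>t c. if t = w then c else t)"
  have fC: "f u c1 \<in> C" "f v c2 \<in> C" "f z c3 \<in> C"
    using uvz ab c by (auto simp: f_def)
  obtain V E where T: "lattice_tree V E" "V \<subseteq> C" "f u c1 \<in> V" "f v c2 \<in> V" "f z c3 \<in> V"
      "sinks V E \<subseteq> X"
      "int (card E) + wt1 (f u c1) + wt2 (f v c2) + wt3 (f z c3) \<le> 5 * (int (card (sinks V E)) - 1)"
    by (rule spannedE[OF C fC])
  show "\<exists>V E. lattice_tree V E \<and> V \<subseteq> insert w C \<and> {u, v, z} \<subseteq> V \<and>
     sinks V E \<subseteq> X \<and> int (card E) + wt1 u + wt2 v + wt3 z \<le> 5 * (int (card (sinks V E)) - 1)"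
  proof (cases "w \<in> {u, v, z}")
    case False
    then show ?thesis
      using T by (intro exI[of _ V] exI[of _ E]) (auto simp: f_def)
  next
    case True
    then obtain c where c': "c \<in> {a, b}" "c \<in> V"
      using T(3-5) c(1-3) by (auto simp: f_def split: if_splits)
    have wc: "(w, c) \<in> edges" using c' children_edges[OF ch] by auto
    have "lattice_tree ({w} \<union> V) (insert (w, c) ({} \<union> E))"
      using T(1,2) w c' wc by (intro lattice_tree_join lattice_tree_singleton) auto
    then have tree: "lattice_tree (insert w V) (insert (w, c) E)" by simp
    have "E \<subseteq> V \<times> V" using T(1) by (auto simp: lattice_tree_def)
    then have "sinks (insert w V) (insert (w, c) E) = sinks V E"
      using T(2) w by (auto simp: sinks_def)
    moreover have "int (card (insert (w, c) E)) + wt1 u + wt2 v + wt3 z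
        \<le> int (card E) + wt1 (f u c1) + wt2 (f v c2) + wt3 (f z c3)"
      using True c(4-6) lattice_tree_finite[OF T(1)] by (auto simp: f_def card_insert_if)
    moreover have "{u, v, z} \<subseteq> insert w V"
      using T(3-5) by (auto simp: f_def split: if_splits)
    ultimately show ?thesis
      using T tree by (intro exI[of _ "insert w V"] exI[of _ "insert (w, c) E"]) auto
  qed
qed

text \<open>A terminal in one cluster stays there, and the other cluster receives its child of
  \<open>w\<close>; a terminal at \<open>w\<close> is replaced by both children. The three
  assumptions on \<open>k\<close> serve the cases \<open>t \<in> B\<close>, \<open>t \<in> A\<close>
  and \<open>t = w\<close>, in this order.\<close>

lemma split_terminal:
  fixes h :: "site \<Rightarrow> int"
  assumes "t \<in> insert w (A \<union> B)" "a \<in> A" "b \<in> B"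
    and "h w + k \<le> h a" "h w + k \<le> h b" "2 * h w + k \<le> h a + h b"
  obtains ta tb where "ta \<in> A" "tb \<in> B" "t \<in> {w, ta, tb}" "t \<notin> A \<Longrightarrow> ta = a" "t \<notin> B \<Longrightarrow> tb = b"
    "h t + h w + k \<le> h ta + h tb"
proof -
  consider "t = w" | "t \<in> A" | "t \<in> B" using assms(1) by blast
  then show ?thesis
  proof cases
    case 1 then show ?thesis using assms that[of a b] by auto
  next
    case 2 then show ?thesis using assms that[of t b] by auto
  next
    case 3 then show ?thesis using assms that[of a t] by auto
  qed
qed

text \<open>This step fixes the factor 5: with \<open>n\<close> and \<open>n'\<close> sinks on the
  two sides, \<open>5 (n - 1) + 5 (n' - 1)\<close> is 5 short of \<open>5 (n + n' - 1)\<close>,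
  which covers exactly the 2 new edges and a weight loss of 3.\<close>

lemma spanned_merge:
  assumes A: "spanned X A" and B: "spanned X B" and disj: "A \<inter> B = {}"
    and w: "w \<notin> A" "w \<notin> B" and ch: "children w a b" and ab: "a \<in> A" "b \<in> B"
  shows "spanned X (insert w (A \<union> B))"
  unfolding spanned_def
proof (intro ballI)
  fix u v z
  assume uvz: "u \<in> insert w (A \<union> B)" "v \<in> insert w (A \<union> B)" "z \<in> insert w (A \<union> B)"
  \<comment> \<open>Joining two trees through \<open>w\<close> costs at most 3 in the total weight of their terminals, and 2 new edges.\<close>
  obtain k1 k2 k3 where k: "k1 + k2 + k3 = (-3 :: int)"
    "wt1 w + k1 \<le> wt1 a" "wt1 w + k1 \<le> wt1 b" "2 * wt1 w + k1 \<le> wt1 a + wt1 b"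
    "wt2 w + k2 \<le> wt2 a" "wt2 w + k2 \<le> wt2 b" "2 * wt2 w + k2 \<le> wt2 a + wt2 b"
    "wt3 w + k3 \<le> wt3 a" "wt3 w + k3 \<le> wt3 b" "2 * wt3 w + k3 \<le> wt3 a + wt3 b"
  proof -
    consider "a = w + (1, 0)" "b = w + (0, 1)" | "a = w + (-1, -1)" "b = w + (0, 1)"
      | "a = w + (-1, -1)" "b = w + (1, 0)"
      using ch by (auto simp: children_def)
    then show ?thesis
    proof cases
      \<comment> \<open>Each \<open>k\<close> is the smaller of the increments of its form from
        \<open>w\<close> to \<open>a\<close> and to \<open>b\<close>: 1 for the form that grows
        along both, -2 for the other two.\<close>
      case 1 then show ?thesis by (intro that[of "-2" "-2" 1]) (simp_all add: wt_defs)
    next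
      case 2 then show ?thesis by (intro that[of 1 "-2" "-2"]) (simp_all add: wt_defs)
    next
      case 3 then show ?thesis by (intro that[of "-2" 1 "-2"]) (simp_all add: wt_defs)
    qed
  qed
  let ?Q = "\<lambda>V E. lattice_tree V E \<and> V \<subseteq> insert w (A \<union> B) \<and> {u, v, z} \<subseteq> V \<and>
     sinks V E \<subseteq> X \<and> int (card E) + wt1 u + wt2 v + wt3 z \<le> 5 * (int (card (sinks V E)) - 1)"
  \<comment> \<open>If one cluster holds all terminals, its own tree serves; only otherwise are the
    two trees joined.\<close>
  consider "u \<in> A" "v \<in> A" "z \<in> A" | "u \<in> B" "v \<in> B" "z \<in> B"
    | "u \<notin> A \<or> v \<notin> A \<or> z \<notin> A" "u \<notin> B \<or> v \<notin> B \<or> z \<notin> B" by blast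
  then show "\<exists>V E. ?Q V E"
  proof cases
    case 1
    obtain V E where "lattice_tree V E" "V \<subseteq> A" "u \<in> V" "v \<in> V" "z \<in> V" "sinks V E \<subseteq> X"
      "int (card E) + wt1 u + wt2 v + wt3 z \<le> 5 * (int (card (sinks V E)) - 1)"
      by (rule spannedE[OF A 1])
    then show ?thesis by blast
  next
    case 2
    obtain V E where "lattice_tree V E" "V \<subseteq> B" "u \<in> V" "v \<in> V" "z \<in> V" "sinks V E \<subseteq> X"
      "int (card E) + wt1 u + wt2 v + wt3 z \<le> 5 * (int (card (sinks V E)) - 1)"
      by (rule spannedE[OF B 2])
    then show ?thesis by blast
  next
    case 3
    obtain ua ub where u: "ua \<in> A" "ub \<in> B" "u \<in> {w, ua, ub}" "u \<notin> A \<Longrightarrow> ua = a" "u \<notin> B \<Longrightarrow> ub = b"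
        "wt1 u + wt1 w + k1 \<le> wt1 ua + wt1 ub"
      using split_terminal[OF uvz(1) ab k(2-4)] by metis
    obtain va vb where v: "va \<in> A" "vb \<in> B" "v \<in> {w, va, vb}" "v \<notin> A \<Longrightarrow> va = a" "v \<notin> B \<Longrightarrow> vb = b"
        "wt2 v + wt2 w + k2 \<le> wt2 va + wt2 vb"
      using split_terminal[OF uvz(2) ab k(5-7)] by metis
    obtain za zb where z: "za \<in> A" "zb \<in> B" "z \<in> {w, za, zb}" "z \<notin> A \<Longrightarrow> za = a" "z \<notin> B \<Longrightarrow> zb = b"
        "wt3 z + wt3 w + k3 \<le> wt3 za + wt3 zb"
      using split_terminal[OF uvz(3) ab k(8-10)] by metis
    obtain V E where T: "lattice_tree V E" "V \<subseteq> A" "ua \<in> V" "va \<in> V" "za \<in> V" "sinks V E \<subseteq> X"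
        "int (card E) + wt1 ua + wt2 va + wt3 za \<le> 5 * (int (card (sinks V E)) - 1)"
      by (rule spannedE[OF A u(1) v(1) z(1)])
    obtain V' E' where T': "lattice_tree V' E'" "V' \<subseteq> B" "ub \<in> V'" "vb \<in> V'" "zb \<in> V'" "sinks V' E' \<subseteq> X"
        "int (card E') + wt1 ub + wt2 vb + wt3 zb \<le> 5 * (int (card (sinks V' E')) - 1)"
      by (rule spannedE[OF B u(2) v(2) z(2)])
    \<comment> \<open>Some terminal lies outside \<open>A\<close>, and its substitute in
      \<open>A\<close> is \<open>a\<close>; so the tree in \<open>A\<close> contains
      \<open>a\<close> and can be attached to \<open>w\<close> there. The same holds for
      \<open>b\<close>.\<close>
    have a: "a \<in> V" using 3(1) u(4) v(4) z(4) T(3-5) by auto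
    have b: "b \<in> V'" using 3(2) u(5) v(5) z(5) T'(3-5) by auto
    have sub: "E \<subseteq> V \<times> V" "E' \<subseteq> V' \<times> V'"
      using T(1) T'(1) by (auto simp: lattice_tree_def)
    have VV': "V \<inter> V' = {}" "w \<notin> V" "w \<notin> V'" using T(2) T'(2) disj w by auto
    let ?V = "insert w V \<union> V'" and ?E = "insert (w, b) (insert (w, a) E \<union> E')"
    have "lattice_tree ({w} \<union> V) (insert (w, a) ({} \<union> E))"
      using T(1) VV' a children_edges(1)[OF ch] by (intro lattice_tree_join lattice_tree_singleton) auto
    then have tree: "lattice_tree ?V ?E"
      using T'(1) VV' b children_edges(2)[OF ch] by (intro lattice_tree_join) auto
    have "card E + card E' + 2 = card ?E"
      using tree T(1) T'(1) VV' lattice_tree_finite[OF T(1)] lattice_tree_finite[OF T'(1)]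
      by (simp add: lattice_tree_def card_Un_disjoint)
    moreover have sinks: "sinks ?V ?E = sinks V E \<union> sinks V' E'"
      using VV' sub by (auto simp: sinks_def)
    moreover have "card (sinks V E \<union> sinks V' E') = card (sinks V E) + card (sinks V' E')"
      using VV' lattice_tree_finite[OF T(1)] lattice_tree_finite[OF T'(1)]
      by (intro card_Un_disjoint) (auto simp: sinks_def)
    moreover have "wt1 w + wt2 w + wt3 w = 0" by (simp add: wt_defs)
    ultimately have "int (card ?E) + wt1 u + wt2 v + wt3 z \<le> 5 * (int (card (sinks ?V ?E)) - 1)"
      using T(7) T'(7) u(6) v(6) z(6) k(1) by simp
    moreover have "{u, v, z} \<subseteq> ?V"
      using T(3-5) T'(3-5) u(3) v(3) z(3) by auto
    ultimately have "?Q ?V ?E"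
      using tree sinks T(2,6) T'(2,6) by auto
    then show ?thesis by blast
  qed
qed

section \<open>Decomposition of infected sets into clusters\<close>

definition clustered :: "site set \<Rightarrow> site set \<Rightarrow> bool" where
  "clustered X D \<longleftrightarrow> (\<exists>\<C>. \<Union>\<C> = D \<and> disjoint \<C> \<and> (\<forall>C\<in>\<C>. spanned X C))"

lemma clustered_empty: "clustered X {}"
  unfolding clustered_def by (rule exI[of _ "{}"]) auto

lemma clustered_insert_seed:
  assumes "clustered X D" "x \<in> X"
  shows "clustered X (insert x D)"
proof (cases "x \<in> D")
  case True
  then show ?thesis using assms by (simp add: insert_absorb)
next
  case False
  obtain \<C> where "\<Union>\<C> = D" "disjoint \<C>" "\<forall>C\<in>\<C>. spanned X C"
    using assms(1) by (auto simp: clustered_def)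
  then show ?thesis
    unfolding clustered_def using False spanned_singleton[OF assms(2)]
    by (intro exI[of _ "insert {x} \<C>"]) (auto simp: pairwise_insert disjnt_def)
qed

text \<open>A new site joins the cluster of its children if they share one, and otherwise merges
  their two clusters. Clusters that are merely adjacent stay separate.\<close>

lemma clustered_insert_step:
  assumes D: "clustered X D" and ch: "children w a b" and ab: "a \<in> D" "b \<in> D"
  shows "clustered X (insert w D)"
proof (cases "w \<in> D")
  case True
  then show ?thesis using D by (simp add: insert_absorb)
next
  case False
  obtain \<C> where C: "\<Union>\<C> = D" "disjoint \<C>" "\<forall>C\<in>\<C>. spanned X C"
    using D by (auto simp: clustered_def)
  obtain A B where AB: "A \<in> \<C>" "a \<in> A" "B \<in> \<C>" "b \<in> B" using ab C(1) by auto
  have w: "w \<notin> A" "w \<notin> B" using False AB C(1) by auto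
  have "spanned X (insert w (A \<union> B))"
  proof (cases "A = B")
    case True
    then show ?thesis using spanned_insert[of X A w a b] C(3) AB w ch by auto
  next
    case False
    then have "A \<inter> B = {}" using C(2) AB by (auto simp: pairwise_def disjnt_def)
    then show ?thesis using spanned_merge[of X A B w a b] C(3) AB w ch by auto
  qed
  moreover have "disjnt (insert w (A \<union> B)) F" if "F \<in> \<C> - {A, B}" for F
  proof -
    have "disjnt A F" "disjnt B F" "w \<notin> F"
      using that C(1,2) AB False by (auto simp: pairwise_def)
    then show ?thesis by simp
  qed
  then have "disjoint (insert (insert w (A \<union> B)) (\<C> - {A, B}))"
    using pairwise_subset[OF C(2)] by (auto simp: pairwise_insert disjnt_sym)
  moreover have "\<Union>(insert (insert w (A \<union> B)) (\<C> - {A, B})) = insert w D"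
    using C(1) AB by auto
  ultimately show ?thesis
    unfolding clustered_def using C(3) by (intro exI[of _ "insert (insert w (A \<union> B)) (\<C> - {A, B})"]) auto
qed

lemma DTBP_children:
  assumes "U \<in> DTBP" "(+) w ` U \<subseteq> Y"
  obtains a b where "children w a b" "a \<in> Y" "b \<in> Y"
  using assms that[of "w + (1, 0)" "w + (0, 1)"] that[of "w + (-1, -1)" "w + (0, 1)"]
    that[of "w + (-1, -1)" "w + (1, 0)"]
  unfolding DTBP_def children_def by auto

text \<open>A bootstrap step may infect infinitely many sites, but sites are added one at a time.
  Hence only finite sets are covered, and the induction passes from \<open>F\<close> to finitely
  many sites that explain it.\<close>

lemma clustered_iter:
  assumes "finite F" "F \<subseteq> bootstrap_iter DTBP X t"
  shows "\<exists>D. F \<subseteq> D \<and> clustered X D"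
  using assms
proof (induction t arbitrary: F)
  case 0
  then have "clustered X F"
    by (induction F rule: finite_induct) (auto intro: clustered_empty clustered_insert_seed)
  then show ?case by blast
next
  case (Suc t)
  let ?Y = "bootstrap_iter DTBP X t"
  have "\<exists>a b. a \<in> ?Y \<and> b \<in> ?Y \<and> (w \<in> ?Y \<or> children w a b)" if "w \<in> F" for w
  proof (cases "w \<in> ?Y")
    case False
    have "w \<in> bootstrap_step DTBP ?Y" using that Suc.prems(2) by auto
    with False obtain U where "U \<in> DTBP" "(+) w ` U \<subseteq> ?Y"
      unfolding bootstrap_step_def by blast
    then show ?thesis by (metis DTBP_children)
  qed blast
  then obtain f g where fg: "\<And>w. w \<in> F \<Longrightarrow> f w \<in> ?Y \<and> g w \<in> ?Y \<and> (w \<in> ?Y \<or> children w (f w) (g w))"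
    by metis
  \<comment> \<open>These sites have to be present before the rest of \<open>F\<close> is added: the
    chosen children, and the part of \<open>F\<close> infected earlier.\<close>
  have "finite (f ` F \<union> g ` F \<union> (F \<inter> ?Y))" "f ` F \<union> g ` F \<union> (F \<inter> ?Y) \<subseteq> ?Y"
    using Suc.prems(1) fg by blast+
  from Suc.IH[OF this] obtain D
    where D: "f ` F \<union> g ` F \<union> (F \<inter> ?Y) \<subseteq> D" "clustered X D" by blast
  have "clustered X (D \<union> G)" if "finite G" "G \<subseteq> F" for G
    using that
  proof (induction G rule: finite_induct)
    case empty
    then show ?case using D(2) by simp
  next
    case (insert w G)
    show ?case
    proof (cases "w \<in> ?Y")
      case True
      then have "w \<in> D" using D(1) insert.prems by auto
      then show ?thesis using insert by (simp add: insert_absorb)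
    next
      case False
      then show ?thesis
        using insert fg[of w] D(1) clustered_insert_step[of X "D \<union> G" w "f w" "g w"] by auto
    qed
  qed
  from this[OF Suc.prems(1)] show ?case by blast
qed

lemma infected_tree:
  assumes "v \<in> bootstrap_closure DTBP X"
  obtains V E where "lattice_tree V E" "v \<in> V" "sinks V E \<subseteq> X"
    "card E + 5 \<le> 5 * card (sinks V E)"
proof -
  obtain t where "v \<in> bootstrap_iter DTBP X t"
    using assms by (auto simp: bootstrap_closure_def)
  then obtain D where "v \<in> D" "clustered X D"
    using clustered_iter[of "{v}" X t] by auto
  then obtain C where C: "v \<in> C" "spanned X C" by (auto simp: clustered_def)
  obtain V E where T: "lattice_tree V E" "v \<in> V" "sinks V E \<subseteq> X"
      "int (card E) + wt1 v + wt2 v + wt3 v \<le> 5 * (int (card (sinks V E)) - 1)"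
    by (rule spannedE[OF C(2) C(1) C(1) C(1)])
  have "wt1 v + wt2 v + wt3 v = 0" by (simp add: wt_defs)
  then show ?thesis using T that by simp
qed

section \<open>Bond percolation clusters\<close>

definition touching :: "site set \<Rightarrow> (site \<times> site) set" where
  "touching V = edges \<inter> (V \<times> UNIV \<union> UNIV \<times> V)"

text \<open>Each site has three outgoing and three incoming edges, and the edges of the tree are
  counted at both ends: \<open>6 (m + 1) - m = 5 m + 6\<close> for \<open>m\<close> tree
  edges.\<close>

lemma card_touching:
  assumes "lattice_tree V E"
  shows "finite (touching V)" "E \<subseteq> touching V" "card (touching V) \<le> 5 * card E + 6"
proof -
  note fin = lattice_tree_finite[OF assms]
  let ?D = "{(1, 0), (0, 1), (-1, -1)} :: site set"
  define P where "P = {e \<in> edges. fst e \<in> V}"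
  define Q where "Q = {e \<in> edges. snd e \<in> V}"
  have VD: "finite (V \<times> ?D)" "card (V \<times> ?D) = 3 * card V"
    using fin by (simp_all add: card_cartesian_product)
  have inj: "inj_on (\<lambda>e :: site \<times> site. (fst e, snd e - fst e)) P"
      "inj_on (\<lambda>e :: site \<times> site. (snd e, snd e - fst e)) Q"
    by (simp_all add: inj_on_def prod_eq_iff)
  have img: "(\<lambda>e. (fst e, snd e - fst e)) ` P \<subseteq> V \<times> ?D" "(\<lambda>e. (snd e, snd e - fst e)) ` Q \<subseteq> V \<times> ?D"
    by (auto simp: P_def Q_def edges_def)
  have PQ: "finite P" "finite Q"
    using inj_on_finite[OF inj(1) img(1) VD(1)] inj_on_finite[OF inj(2) img(2) VD(1)] .
  have card: "card P \<le> 3 * card V" "card Q \<le> 3 * card V"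
    using card_inj_on_le[OF inj(1) img(1) VD(1)] card_inj_on_le[OF inj(2) img(2) VD(1)] VD(2)
    by simp_all
  have touch: "touching V = P \<union> Q" by (auto simp: touching_def P_def Q_def)
  show "finite (touching V)" using PQ touch by simp
  have E: "E \<subseteq> edges \<inter> V \<times> V" using assms by (simp add: lattice_tree_def)
  then show "E \<subseteq> touching V" by (auto simp: touching_def)
  from E have "E \<subseteq> P \<inter> Q" by (auto simp: P_def Q_def)
  then have "card E \<le> card (P \<inter> Q)" using PQ by (intro card_mono) auto
  moreover have "card (P \<union> Q) + card (P \<inter> Q) = card P + card Q"
    using card_Un_Int[OF PQ] by simp
  moreover have "card V = Suc (card E)" using assms by (simp add: lattice_tree_def)
  ultimately show "card (touching V) \<le> 5 * card E + 6" using card touch by simp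
qed

text \<open>For a lattice tree this says that \<open>V\<close> is the undirected open cluster of
  each of its sites and that \<open>E\<close> consists of all open edges meeting
  \<open>V\<close>.\<close>

definition open_cluster :: "site set \<Rightarrow> (site \<times> site) set \<Rightarrow> (site \<times> site \<Rightarrow> bool) \<Rightarrow> bool" where
  "open_cluster V E \<eta> \<longleftrightarrow> (\<forall>e\<in>touching V. \<eta> e \<longleftrightarrow> e \<in> E)"

text \<open>Follow a path of the second tree from \<open>c\<close>. Its edges are open, and an open
  edge meeting \<open>V\<close> belongs to \<open>E\<close>, so the path never leaves
  \<open>V\<close>.\<close>

lemma open_cluster_subset:
  assumes T: "lattice_tree V E" "lattice_tree V' E'" and c: "c \<in> V" "c \<in> V'"
    and \<eta>: "open_cluster V E \<eta>" "open_cluster V' E' \<eta>"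
  shows "V' \<subseteq> V"
proof
  fix v assume "v \<in> V'"
  then have "(c, v) \<in> (E' \<union> E'\<inverse>)\<^sup>*" using T(2) c(2) by (simp add: lattice_tree_def)
  then show "v \<in> V"
  proof (induction rule: rtrancl_induct)
    case base
    then show ?case using c(1) .
  next
    case (step y z)
    then obtain e where e: "e \<in> E'" "e \<in> {(y, z), (z, y)}" by blast
    then have "\<eta> e" using \<eta>(2) card_touching(2)[OF T(2)] by (auto simp: open_cluster_def)
    moreover have "e \<in> touching V"
      using e step.IH T(2) by (auto simp: touching_def lattice_tree_def)
    ultimately have "e \<in> E" using \<eta>(1) by (auto simp: open_cluster_def)
    then show ?case using e T(1) by (auto simp: lattice_tree_def)
  qed
qed

text \<open>This makes the percolation events of distinct trees through a common site disjoint,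
  which takes the place of counting trees.\<close>

lemma open_cluster_unique:
  assumes "lattice_tree V E" "lattice_tree V' E'" "c \<in> V" "c \<in> V'"
    and "open_cluster V E \<eta>" "open_cluster V' E' \<eta>"
  shows "V = V'" "E = E'"
proof -
  show V: "V = V'" using open_cluster_subset assms by (meson subset_antisym)
  have "E = {e \<in> touching V. \<eta> e}" "E' = {e \<in> touching V'. \<eta> e}"
    using assms card_touching(2) by (fastforce simp: open_cluster_def)+
  then show "E = E'" using V by simp
qed

section \<open>Comparison of site and edge probabilities\<close>

lemma bernoulli_cylinder:
  fixes J :: "'a set"
  assumes "finite J"
  shows "{\<eta>. \<forall>x\<in>J. \<eta> x = b x} \<in> sets (\<Pi>\<^sub>M x\<in>UNIV. measure_pmf (bernoulli_pmf p))"
    and "emeasure (\<Pi>\<^sub>M x\<in>UNIV. measure_pmf (bernoulli_pmf p)) {\<eta>. \<forall>x\<in>J. \<eta> x = b x} =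
      ennreal (\<Prod>x\<in>J. pmf (bernoulli_pmf p) (b x))"
proof -
  let ?M = "\<Pi>\<^sub>M x\<in>UNIV. measure_pmf (bernoulli_pmf p)"
  interpret product_prob_space "\<lambda>_. measure_pmf (bernoulli_pmf p)" UNIV
    by unfold_locales
  have eq: "{\<eta>. \<forall>x\<in>J. \<eta> x = b x} = {\<eta> \<in> space ?M. \<forall>x\<in>J. \<eta> x \<in> {b x}}"
    by (simp add: space_PiM PiE_UNIV_domain)
  show "{\<eta>. \<forall>x\<in>J. \<eta> x = b x} \<in> sets ?M"
    unfolding eq
  proof (rule sets.sets_Collect_finite_All[OF _ assms])
    fix x :: 'a
    have "(\<lambda>\<eta>. \<eta> x) \<in> measurable ?M (measure_pmf (bernoulli_pmf p))"
      by (rule measurable_component_singleton) simp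
    from measurable_sets[OF this, of "{b x}"] show "{\<eta> \<in> space ?M. \<eta> x \<in> {b x}} \<in> sets ?M"
      by (simp add: vimage_def Int_def conj_commute)
  qed
  show "emeasure ?M {\<eta>. \<forall>x\<in>J. \<eta> x = b x} = ennreal (\<Prod>x\<in>J. pmf (bernoulli_pmf p) (b x))"
    unfolding eq using assms
    by (subst emeasure_PiM_Collect) (auto simp: emeasure_pmf_single prod_ennreal)
qed

text \<open>Subadditivity is applied in \<open>M\<close> and countable additivity in
  \<open>N\<close>, where the events are disjoint.\<close>

lemma emeasure_UN_compare:
  assumes "countable I" "\<And>i. i \<in> I \<Longrightarrow> A i \<in> sets M" "\<And>i. i \<in> I \<Longrightarrow> B i \<in> sets N"
    and "disjoint_family_on B I" "\<And>i. i \<in> I \<Longrightarrow> emeasure M (A i) \<le> c * emeasure N (B i)"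
  shows "emeasure M (\<Union>i\<in>I. A i) \<le> c * emeasure N (\<Union>i\<in>I. B i)"
proof -
  \<comment> \<open>Both unions are enumerated by natural numbers, with the empty set at indices
    outside the range of the encoding.\<close>
  have UN: "(\<Union>i\<in>I. F i) = (\<Union>n. if n \<in> to_nat_on I ` I then F (from_nat_into I n) else {})"
    for F :: "'a \<Rightarrow> 'd set"
    using assms(1) by (auto split: if_splits)
  let ?A = "\<lambda>n. if n \<in> to_nat_on I ` I then A (from_nat_into I n) else {}"
  let ?B = "\<lambda>n. if n \<in> to_nat_on I ` I then B (from_nat_into I n) else {}"
  have "emeasure M (\<Union>n. ?A n) \<le> (\<Sum>n. emeasure M (?A n))"
    using assms(1,2) by (intro emeasure_subadditive_countably) auto
  also have "\<dots> \<le> (\<Sum>n. c * emeasure N (?B n))"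
    using assms(1,5) by (intro suminf_le) auto
  also have "\<dots> = c * (\<Sum>n. emeasure N (?B n))"
    by simp
  also have "(\<Sum>n. emeasure N (?B n)) = emeasure N (\<Union>n. ?B n)"
  proof (rule suminf_emeasure)
    show "range ?B \<subseteq> sets N" using assms(1,3) by auto
    have "\<forall>i\<in>I. \<forall>j\<in>I. \<forall>x. x \<in> B i \<longrightarrow> x \<in> B j \<longrightarrow> i = j"
      using assms(4) unfolding disjoint_family_on_def by blast
    then show "disjoint_family ?B"
      using assms(1) by (auto simp: disjoint_family_on_def)
  qed
  finally show ?thesis unfolding UN .
qed

text \<open>Besides the \<open>m\<close> open edges at most \<open>4 m + 6\<close> edges must be
  closed. The density \<open>q = 1/5\<close> maximises \<open>q (1 - q)^4\<close>, with maximum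
  256/3125.\<close>

lemma prob_open_cluster:
  assumes "lattice_tree V E"
  shows "{\<eta>. open_cluster V E \<eta>} \<in> sets (\<Pi>\<^sub>M e\<in>UNIV. measure_pmf (bernoulli_pmf (1/5)))"
    and "ennreal ((4/5) ^ 6 * (256/3125) ^ card E) \<le>
      emeasure (\<Pi>\<^sub>M e\<in>UNIV. measure_pmf (bernoulli_pmf (1/5))) {\<eta>. open_cluster V E \<eta>}"
proof -
  let ?N = "\<Pi>\<^sub>M e\<in>UNIV. measure_pmf (bernoulli_pmf (1/5))"
  note touch = card_touching[OF assms]
  have eq: "{\<eta>. open_cluster V E \<eta>} = {\<eta>. \<forall>e\<in>touching V. \<eta> e = (e \<in> E)}"
    by (simp add: open_cluster_def)
  show "{\<eta>. open_cluster V E \<eta>} \<in> sets ?N"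
    unfolding eq by (rule bernoulli_cylinder) (rule touch)
  have "(\<Prod>e\<in>touching V. pmf (bernoulli_pmf (1/5)) (e \<in> E)) =
      (\<Prod>e\<in>touching V - E. pmf (bernoulli_pmf (1/5)) (e \<in> E)) * (\<Prod>e\<in>E. pmf (bernoulli_pmf (1/5)) (e \<in> E))"
    using touch by (intro prod.subset_diff) auto
  also have "\<dots> = (4/5) ^ card (touching V - E) * (1/5) ^ card E" by simp
  finally have prod: "(\<Prod>e\<in>touching V. pmf (bernoulli_pmf (1/5)) (e \<in> E)) =
      (4/5) ^ card (touching V - E) * (1/5) ^ card E" .
  have "card (touching V - E) \<le> 6 + 4 * card E"
    using touch finite_subset[OF touch(2,1)] by (simp add: card_Diff_subset)
  then have "(4/5 :: real) ^ (6 + 4 * card E) \<le> (4/5) ^ card (touching V - E)"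
    by (intro power_decreasing) auto
  then have "(4/5 :: real) ^ (6 + 4 * card E) * (1/5) ^ card E \<le> (4/5) ^ card (touching V - E) * (1/5) ^ card E"
    by (rule mult_right_mono) simp
  moreover have "(4/5 :: real) ^ (6 + 4 * card E) * (1/5) ^ card E = (4/5) ^ 6 * (((4/5) ^ 4 * (1/5)) ^ card E)"
    by (simp only: power_add power_mult power_mult_distrib mult.assoc)
  moreover have "(4/5) ^ 4 * (1/5) = (256/3125 :: real)" by (simp add: power_divide)
  ultimately have "(4/5) ^ 6 * (256/3125) ^ card E \<le> (\<Prod>e\<in>touching V. pmf (bernoulli_pmf (1/5)) (e \<in> E))"
    unfolding prod by metis
  then show "ennreal ((4/5) ^ 6 * (256/3125) ^ card E) \<le> emeasure ?N {\<eta>. open_cluster V E \<eta>}"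
    unfolding eq bernoulli_cylinder(2)[OF touch(1)] by (rule ennreal_leI)
qed

section \<open>Union bound and the critical parameter\<close>

lemma prob_infected_less_1:
  assumes p: "0 \<le> p" "p \<le> (256/3125) ^ 5"
  shows "emeasure (site_measure p) {\<omega>. 0 \<in> bootstrap_closure DTBP {x. \<omega> x}} < 1"
proof -
  let ?N = "\<Pi>\<^sub>M e\<in>UNIV. measure_pmf (bernoulli_pmf (1/5)) :: (site \<times> site \<Rightarrow> bool) measure"
  \<comment> \<open>The fifth power comes from the slack 5 in
    \<open>card E + 5 \<le> 5 * card (sinks V E)\<close>; the factor \<open>(5/4) ^ 6\<close>
    cancels the constant in the lower bound for the percolation event.\<close>
  define c :: real where "c = (256/3125) ^ 5 * (5/4) ^ 6"
  define T where "T = {(V, E). lattice_tree V E \<and> (0::site) \<in> V \<and> card E + 5 \<le> 5 * card (sinks V E)}"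
  let ?A = "\<lambda>(V, E). {\<omega>. \<forall>x\<in>sinks V E. \<omega> x = True}"
  let ?B = "\<lambda>(V, E). {\<eta>. open_cluster V E \<eta>}"
  have fin: "finite (sinks V E)" if "lattice_tree V E" for V E
    using lattice_tree_finite[OF that] by (simp add: sinks_def)
  have "T \<subseteq> {V. finite V} \<times> {E. finite E}"
    by (auto simp: T_def dest: lattice_tree_finite)
  then have count: "countable T"
    by (rule countable_subset) (intro countable_SIGMA countable_Collect_finite)
  have "emeasure (site_measure p) (?A i) \<le> ennreal c * emeasure ?N (?B i)" if "i \<in> T" for i
  proof -
    obtain V E where i: "i = (V, E)" by force
    have VE: "lattice_tree V E" "card E + 5 \<le> 5 * card (sinks V E)"
      using that by (auto simp: T_def i)
    have p1: "p \<le> 1" using p(2) by (simp add: power_divide)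
    have "p ^ card (sinks V E) \<le> ((256/3125) ^ 5) ^ card (sinks V E)"
      using p by (intro power_mono) auto
    also have "\<dots> = (256/3125) ^ (5 * card (sinks V E))" by (rule power_mult[symmetric])
    also have "\<dots> \<le> (256/3125) ^ (card E + 5)"
      using VE(2) by (intro power_decreasing) auto
    also have "\<dots> = c * ((4/5) ^ 6 * (256/3125) ^ card E)"
      by (simp add: c_def power_add power_divide)
    finally have le: "p ^ card (sinks V E) \<le> c * ((4/5) ^ 6 * (256/3125) ^ card E)" .
    have "emeasure (site_measure p) (?A i) = ennreal (p ^ card (sinks V E))"
      unfolding i site_measure_def prod.case bernoulli_cylinder(2)[OF fin[OF VE(1)]]
      using p(1) p1 by simp
    also have "\<dots> \<le> ennreal (c * ((4/5) ^ 6 * (256/3125) ^ card E))"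
      using le by (rule ennreal_leI)
    also have "\<dots> = ennreal c * ennreal ((4/5) ^ 6 * (256/3125) ^ card E)"
      by (intro ennreal_mult) (auto simp: c_def)
    also have "\<dots> \<le> ennreal c * emeasure ?N (?B i)"
      unfolding i prod.case by (intro mult_left_mono prob_open_cluster VE(1)) simp
    finally show ?thesis .
  qed
  moreover have A: "?A i \<in> sets (site_measure p)" if "i \<in> T" for i
  proof -
    obtain V E where i: "i = (V, E)" by force
    show ?thesis
      unfolding i site_measure_def prod.case
      by (rule bernoulli_cylinder(1)) (use that in \<open>auto simp: i T_def intro: fin\<close>)
  qed
  moreover have "?B i \<in> sets ?N" if "i \<in> T" for i
    using that prob_open_cluster(1) unfolding T_def by auto
  moreover have "disjoint_family_on ?B T"
  proof -
    have "i = j" if "i \<in> T" "j \<in> T" "\<eta> \<in> ?B i" "\<eta> \<in> ?B j" for i j \<eta>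
    proof -
      obtain V E V' E' where ij: "i = (V, E)" "j = (V', E')" by force
      then have "lattice_tree V E" "lattice_tree V' E'" "0 \<in> V" "0 \<in> V'"
          "open_cluster V E \<eta>" "open_cluster V' E' \<eta>"
        using that by (simp_all add: T_def)
      from open_cluster_unique[OF this] show ?thesis by (simp add: ij)
    qed
    then show ?thesis unfolding disjoint_family_on_def by blast
  qed
  ultimately have "emeasure (site_measure p) (\<Union>i\<in>T. ?A i) \<le> ennreal c * emeasure ?N (\<Union>i\<in>T. ?B i)"
    using count by (intro emeasure_UN_compare) auto
  also have "\<dots> \<le> ennreal c * 1"
    by (intro mult_left_mono prob_space.emeasure_le_1 prob_space_PiM measure_pmf.prob_space_axioms) simp
  also have "\<dots> < 1"
    by (simp add: c_def power_divide ennreal_less_one_iff)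
  finally have less: "emeasure (site_measure p) (\<Union>i\<in>T. ?A i) < 1" .
  have sub: "{\<omega>. 0 \<in> bootstrap_closure DTBP {x. \<omega> x}} \<subseteq> (\<Union>i\<in>T. ?A i)"
  proof
    fix \<omega> assume "\<omega> \<in> {\<omega>. 0 \<in> bootstrap_closure DTBP {x. \<omega> x}}"
    then have "0 \<in> bootstrap_closure DTBP {x. \<omega> x}" by (rule CollectD)
    then obtain V E where "lattice_tree V E" "0 \<in> V" "sinks V E \<subseteq> {x. \<omega> x}"
        "card E + 5 \<le> 5 * card (sinks V E)"
      by (rule infected_tree)
    then show "\<omega> \<in> (\<Union>i\<in>T. ?A i)"
      by (intro UN_I[of "(V, E)"]) (auto simp: T_def)
  qed
  have "(\<Union>i\<in>T. ?A i) \<in> sets (site_measure p)"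
    by (rule sets.countable_UN'[OF count image_subsetI[OF A]])
  then show ?thesis
    by (rule le_less_trans[OF emeasure_mono[OF sub] less])
qed

theorem theorem1p3:
  shows "critical_parameter DTBP > 2.8 * 10 powi (-6)"
proof -
  have fin: "finite DTBP" "\<And>U. U \<in> DTBP \<Longrightarrow> finite U"
    by (auto simp: DTBP_def)
  have "(256/3125) ^ 5 \<le> critical_parameter DTBP"
    unfolding critical_parameter_def
  proof (rule cInf_greatest)
    show "{p \<in> {0..1}. measure (site_measure p)
        {\<omega> \<in> space (site_measure p). bootstrap_closure DTBP {x. \<omega> x} = UNIV} = 1} \<noteq> {}"
      using one_in_critical_set[OF fin] by blast
  next
    fix p :: real
    assume "p \<in> {p \<in> {0..1}. measure (site_measure p)
        {\<omega> \<in> space (site_measure p). bootstrap_closure DTBP {x. \<omega> x} = UNIV} = 1}"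
    then have p: "0 \<le> p" and
      one: "measure (site_measure p) {\<omega>. bootstrap_closure DTBP {x. \<omega> x} = UNIV} = 1"
      by auto
    interpret prob_space "site_measure p" by (rule prob_space_site_measure)
    note [measurable] = pred_bootstrap_iter[OF fin]
    \<comment> \<open>Monotonicity of the measure needs the larger event, infection of the origin,
      to be measurable.\<close>
    have "{\<omega> \<in> space (site_measure p). \<exists>t. 0 \<in> bootstrap_iter DTBP {x. \<omega> x} t} \<in> sets (site_measure p)"
      by measurable
    then have "{\<omega>. 0 \<in> bootstrap_closure DTBP {x. \<omega> x}} \<in> sets (site_measure p)"
      by (simp add: bootstrap_closure_def)
    then have "emeasure (site_measure p) {\<omega>. bootstrap_closure DTBP {x. \<omega> x} = UNIV}
        \<le> emeasure (site_measure p) {\<omega>. 0 \<in> bootstrap_closure DTBP {x. \<omega> x}}"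
      by (intro emeasure_mono) auto
    then have "1 \<le> emeasure (site_measure p) {\<omega>. 0 \<in> bootstrap_closure DTBP {x. \<omega> x}}"
      using one by (simp add: emeasure_eq_measure)
    then show "(256/3125) ^ 5 \<le> p"
      using prob_infected_less_1[OF p] by (meson leD linear)
  qed
  moreover have "2.8 * 10 powi (-6) < (256/3125 :: real) ^ 5"
    by (simp add: power_int_minus power_divide)
  ultimately show ?thesis by linarith
qed

end
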